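(* Let $N\ge 0$ be an integer and $G>0$. The coefficient matrices $A_L(U)$ and $B_L(U)$ of the two-dimensional shallow water linearized moment equations (SWLME) satisfy $$\cos\theta\,A_L(U)+\sin\theta\,B_L(U)=T(\theta)^{-1}A_L(T(\theta)U)\,T(\theta)$$ for all $\theta\in[0,2\pi)$ and all $U\in\mathcal A_N$.
   Context: State space: $\mathcal A_N=\{U\in\mathbb R^{2N+3}: h>0\}$, where the components of the state vector are written $$U=(h,hu_m,hv_m,h\alpha_1,h\beta_1,\ldots,h\alpha_N,h\beta_N)^T,$$ so that $u_m,v_m,\alpha_j,\beta_j$ are the functions of $U$ obtained by dividing the corresponding component by $h$ (the first component). Fluxes: $$F_L(U)=\Big(hu_m,\;h\big(u_m^2+\sum_{j=1}^N\tfrac{\alpha_j^2}{2j+1}\big)+\tfrac12Gh^2,\;h\big(u_mv_m+\sum_{j=1}^N\tfrac{\alpha_j\beta_j}{2j+1}\big),\;2hu_m\alpha_1,\;h(u_m\beta_1+v_m\alpha_1),\ldots,2hu_m\alpha_N,\;h(u_m\beta_N+v_m\alpha_N)\Big)^T,$$ $$G_L(U)=\Big(hv_m,\;h\big(u_mv_m+\sum_{j=1}^N\tfrac{\alpha_j\beta_j}{2j+1}\big),\;h\big(v_m^2+\sum_{j=1}^N\tfrac{\beta_j^2}{2j+1}\big)+\tfrac12Gh^2,\;h(u_m\beta_1+v_m\alpha_1),\;2hv_m\beta_1,\ldots,h(u_m\beta_N+v_m\alpha_N),\;2hv_m\beta_N\Big)^T.$$ Non-conservative matrices: $P_1(U)=\mathrm{diag}(0_{3\times3},p(U),\ldots,p(U))$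 and $Q_1(U)=\mathrm{diag}(0_{3\times3},q(U),\ldots,q(U))$ (block diagonal, $N$ copies of the $2\times2$ block), with $$p(U)=\begin{pmatrix}-u_m&0\\-v_m&0\end{pmatrix},\qquad q(U)=\begin{pmatrix}0&-u_m\\0&-v_m\end{pmatrix}.$$ Coefficient matrices: $A_L(U)=\partial_UF_L(U)+P_1(U)$, $B_L(U)=\partial_UG_L(U)+Q_1(U)$, where $\partial_U$ is the Jacobian with respect to the components of $U$. Rotation: $T_2(\theta)=\begin{pmatrix}\cos\theta&\sin\theta\\-\sin\theta&\cos\theta\end{pmatrix}$ and $T(\theta)=\mathrm{diag}(1,T_2(\theta),\ldots,T_2(\theta))\in\mathbb R^{(2N+3)\times(2N+3)}$ (with $N+1$ copies of $T_2(\theta)$). *)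

theory Defs
  imports "HOL-Analysis.Derivative" "Jordan_Normal_Form.Gauss_Jordan_Elimination"
begin

unbundle no vec_syntax

hide_type (open) Finite_Cartesian_Product.vec

text \<open>
  The indices of the state vector
  \<open>U = (h, h u\<^sub>m, h v\<^sub>m, h \<alpha>\<^sub>1, h \<beta>\<^sub>1, \<dots>, h \<alpha>\<^sub>N, h \<beta>\<^sub>N)\<close> start at 0, so for \<open>1 \<le> j \<le> N\<close> the
  components \<open>h \<alpha>\<^sub>j\<close> and \<open>h \<beta>\<^sub>j\<close> are \<open>U $ (2 * j + 1)\<close> and \<open>U $ (2 * j + 2)\<close>.
\<close>

definition height :: "real vec \<Rightarrow> real" where
  "height U = U $ 0"

definition u_mean :: "real vec \<Rightarrow> real" where
  "u_mean U = U $ 1 / height U"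

definition v_mean :: "real vec \<Rightarrow> real" where
  "v_mean U = U $ 2 / height U"

definition alpha :: "real vec \<Rightarrow> nat \<Rightarrow> real" where
  "alpha U j = U $ (2 * j + 1) / height U"

definition beta :: "real vec \<Rightarrow> nat \<Rightarrow> real" where
  "beta U j = U $ (2 * j + 2) / height U"

definition state_space :: "nat \<Rightarrow> real vec set" where
  "state_space N = {U \<in> carrier_vec (2 * N + 3). height U > 0}"

definition flux_x :: "nat \<Rightarrow> real \<Rightarrow> real vec \<Rightarrow> real vec" where
  "flux_x N G U =
    (let h = height U; u = u_mean U; v = v_mean U; \<alpha> = alpha U; \<beta> = beta U in
     vec_of_list
       ([h * u,
         h * (u\<^sup>2 + (\<Sum>j = 1..N. (\<alpha> j)\<^sup>2 / real (2 * j + 1))) + 1 / 2 * G * h\<^sup>2,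
         h * (u * v + (\<Sum>j = 1..N. \<alpha> j * \<beta> j / real (2 * j + 1)))] @
        concat (map (\<lambda>j. [2 * h * u * \<alpha> j, h * (u * \<beta> j + v * \<alpha> j)]) [1..<N + 1])))"

definition flux_y :: "nat \<Rightarrow> real \<Rightarrow> real vec \<Rightarrow> real vec" where
  "flux_y N G U =
    (let h = height U; u = u_mean U; v = v_mean U; \<alpha> = alpha U; \<beta> = beta U in
     vec_of_list
       ([h * v,
         h * (u * v + (\<Sum>j = 1..N. \<alpha> j * \<beta> j / real (2 * j + 1))),
         h * (v\<^sup>2 + (\<Sum>j = 1..N. (\<beta> j)\<^sup>2 / real (2 * j + 1))) + 1 / 2 * G * h\<^sup>2] @
        concat (map (\<lambda>j. [h * (u * \<beta> j + v * \<alpha> j), 2 * h * v * \<beta> j]) [1..<N + 1])))"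

text \<open>The matrix of partial derivatives \<open>\<partial>F\<^sub>i / \<partial>U\<^sub>j\<close>, with row index \<open>i\<close> and column index \<open>j\<close>.\<close>

definition jacobian :: "(real vec \<Rightarrow> real vec) \<Rightarrow> real vec \<Rightarrow> real mat" where
  "jacobian F U = mat (dim_vec (F U)) (dim_vec U)
     (\<lambda>(i, j). deriv (\<lambda>t. F (U + t \<cdot>\<^sub>v unit_vec (dim_vec U) j) $ i) 0)"

definition p_block :: "real vec \<Rightarrow> real mat" where
  "p_block U = mat_of_rows_list 2 [[- u_mean U, 0], [- v_mean U, 0]]"

definition q_block :: "real vec \<Rightarrow> real mat" where
  "q_block U = mat_of_rows_list 2 [[0, - u_mean U], [0, - v_mean U]]"

definition P_noncons :: "nat \<Rightarrow> real vec \<Rightarrow> real mat" where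
  "P_noncons N U = diag_block_mat (0\<^sub>m 3 3 # replicate N (p_block U))"

definition Q_noncons :: "nat \<Rightarrow> real vec \<Rightarrow> real mat" where
  "Q_noncons N U = diag_block_mat (0\<^sub>m 3 3 # replicate N (q_block U))"

definition A_coeff :: "nat \<Rightarrow> real \<Rightarrow> real vec \<Rightarrow> real mat" where
  "A_coeff N G U = jacobian (flux_x N G) U + P_noncons N U"

definition B_coeff :: "nat \<Rightarrow> real \<Rightarrow> real vec \<Rightarrow> real mat" where
  "B_coeff N G U = jacobian (flux_y N G) U + Q_noncons N U"

definition rot2 :: "real \<Rightarrow> real mat" where
  "rot2 \<theta> = mat_of_rows_list 2 [[cos \<theta>, sin \<theta>], [- sin \<theta>, cos \<theta>]]"

definition rotation :: "nat \<Rightarrow> real \<Rightarrow> real mat" where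
  "rotation N \<theta> = diag_block_mat (1\<^sub>m 1 # replicate (N + 1) (rot2 \<theta>))"

lemma rot2_mult_uminus: "rot2 \<theta> * rot2 (- \<theta>) = 1\<^sub>m 2"
proof (rule eq_matI)
  fix i j :: nat
  assume "i < dim_row (1\<^sub>m 2 :: real mat)" "j < dim_col (1\<^sub>m 2 :: real mat)"
  then consider "i = 0" "j = 0" | "i = 0" "j = 1" | "i = 1" "j = 0" | "i = 1" "j = 1"
    by fastforce
  then show "(rot2 \<theta> * rot2 (- \<theta>)) $$ (i, j) = 1\<^sub>m 2 $$ (i, j)"
    using sin_cos_squared_add3[of \<theta>]
    by cases (simp_all add: rot2_def mat_of_rows_list_def scalar_prod_def numeral_2_eq_2 add.commute)
qed (simp_all add: rot2_def mat_of_rows_list_def)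

lemma rot2_carrier: "rot2 \<theta> \<in> carrier_mat 2 2"
  by (auto simp: rot2_def mat_of_rows_list_def)

lemma diag_block_replicate_carrier:
  assumes "A \<in> carrier_mat n n"
  shows "diag_block_mat (replicate k A) \<in> carrier_mat (k * n) (k * n)"
proof (induction k)
  case (Suc k)
  then show ?case
    using four_block_carrier_mat[OF assms Suc] by (simp add: Let_def)
qed simp

lemma diag_block_replicate_inverse:
  fixes A B :: "real mat"
  assumes "A \<in> carrier_mat n n" "B \<in> carrier_mat n n" "A * B = 1\<^sub>m n"
  shows "diag_block_mat (replicate k A) * diag_block_mat (replicate k B) = 1\<^sub>m (k * n)"
proof (induction k)
  case (Suc k)
  let ?A = "diag_block_mat (replicate k A)" and ?B = "diag_block_mat (replicate k B)"
  have c: "?A \<in> carrier_mat (k * n) (k * n)" "?B \<in> carrier_mat (k * n) (k * n)"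
    by (rule diag_block_replicate_carrier, fact)+
  have "diag_block_mat (replicate (Suc k) A) * diag_block_mat (replicate (Suc k) B) =
      four_block_mat A (0\<^sub>m n (k * n)) (0\<^sub>m (k * n) n) ?A *
      four_block_mat B (0\<^sub>m n (k * n)) (0\<^sub>m (k * n) n) ?B"
    unfolding replicate_Suc diag_block_mat.simps Let_def
      carrier_matD[OF assms(1)] carrier_matD[OF assms(2)] carrier_matD[OF c(1)] carrier_matD[OF c(2)]
    by (rule refl)
  also have "\<dots> = four_block_mat (1\<^sub>m n) (0\<^sub>m n (k * n)) (0\<^sub>m (k * n) n) (1\<^sub>m (k * n))"
    using assms c Suc
    by (simp add: mult_four_block_mat[OF assms(1) zero_carrier_mat zero_carrier_mat c(1)
          assms(2) zero_carrier_mat zero_carrier_mat c(2)])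
  finally show ?case
    by simp
qed auto

lemma rotation_carrier: "rotation N \<theta> \<in> carrier_mat (2 * N + 3) (2 * N + 3)"
proof -
  have "rotation N \<theta> \<in> carrier_mat (1 + (N + 1) * 2) (1 + (N + 1) * 2)"
    unfolding rotation_def diag_block_mat.simps Let_def
    by (intro four_block_carrier_mat one_carrier_mat diag_block_replicate_carrier rot2_carrier)
  moreover have "1 + (N + 1) * 2 = 2 * N + 3"
    by simp
  ultimately show ?thesis
    by metis
qed

lemma rotation_mult_uminus: "rotation N \<theta> * rotation N (- \<theta>) = 1\<^sub>m (2 * N + 3)"
proof -
  define k where "k = N + 1"
  let ?D = "\<lambda>\<theta>. diag_block_mat (replicate k (rot2 \<theta>))"
  have c: "?D \<theta> \<in> carrier_mat (k * 2) (k * 2)" for \<theta>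
    by (rule diag_block_replicate_carrier[OF rot2_carrier])
  have r: "rotation N \<theta> = four_block_mat (1\<^sub>m 1) (0\<^sub>m 1 (k * 2)) (0\<^sub>m (k * 2) 1) (?D \<theta>)" for \<theta>
    unfolding rotation_def k_def[symmetric] diag_block_mat.simps Let_def
      carrier_matD[OF c] index_one_mat(2,3)
    by (rule refl)
  have "?D \<theta> * ?D (- \<theta>) = 1\<^sub>m (k * 2)"
    by (rule diag_block_replicate_inverse[OF rot2_carrier rot2_carrier rot2_mult_uminus])
  then have "rotation N \<theta> * rotation N (- \<theta>) =
      four_block_mat (1\<^sub>m 1) (0\<^sub>m 1 (k * 2)) (0\<^sub>m (k * 2) 1) (1\<^sub>m (k * 2))"
    unfolding r using c[of \<theta>] c[of "- \<theta>"]
    by (simp add: mult_four_block_mat[OF one_carrier_mat zero_carrier_mat zero_carrier_mat c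
          one_carrier_mat zero_carrier_mat zero_carrier_mat c])
  also have "\<dots> = 1\<^sub>m (1 + k * 2)"
    by (rule four_block_one_mat)
  also have "1 + k * 2 = 2 * N + 3"
    by (simp add: k_def)
  finally show ?thesis .
qed

text \<open>
  \<open>mat_inverse\<close> returns an option; the rotation matrix is invertible, so \<open>the (mat_inverse \<dots>)\<close>
  is its genuine two-sided inverse.
\<close>

lemma mat_inverse_rotation: "mat_inverse (rotation N \<theta>) = Some (rotation N (- \<theta>))"
proof (cases "mat_inverse (rotation N \<theta>)")
  case None
  then have "rotation N \<theta> \<notin> Units (ring_mat TYPE(real) (2 * N + 3) ())"
    by (rule mat_inverse(1)[OF rotation_carrier])
  then show ?thesis
    using rotation_mult_uminus[of N \<theta>] rotation_mult_uminus[of N "- \<theta>"]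
      rotation_carrier[of N \<theta>] rotation_carrier[of N "- \<theta>"]
    unfolding Units_def ring_mat_simps minus_minus by blast
next
  case (Some C)
  have C: "C * rotation N \<theta> = 1\<^sub>m (2 * N + 3)" "C \<in> carrier_mat (2 * N + 3) (2 * N + 3)"
    using mat_inverse(2)[OF rotation_carrier Some] by auto
  have "C = C * (rotation N \<theta> * rotation N (- \<theta>))"
    unfolding rotation_mult_uminus by (rule right_mult_one_mat[OF C(2), symmetric])
  also have "\<dots> = C * rotation N \<theta> * rotation N (- \<theta>)"
    by (rule assoc_mult_mat[OF C(2) rotation_carrier rotation_carrier, symmetric])
  also have "\<dots> = rotation N (- \<theta>)"
    unfolding C(1) by (rule left_mult_one_mat[OF rotation_carrier])
  finally show ?thesis
    using Some by simp
qed

end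

theory Submission
  imports Defs
begin

text \<open>
  With \<open>w = (u\<^sub>m, v\<^sub>m)\<close> and \<open>a\<^sub>j = (\<alpha>\<^sub>j, \<beta>\<^sub>j)\<close> the two fluxes are the two columns of tensors built
  from \<open>w\<close> and the \<open>a\<^sub>j\<close>, so that \<open>cos \<theta> F(U) + sin \<theta> G(U) = T(\<theta>)\<^sup>-\<^sup>1 F(T(\<theta>) U)\<close>.
  Differentiating this along every line \<open>U + t W\<close> gives the identity for the Jacobians; for the
  nonconservative part it holds because \<open>p(U)\<close> and \<open>q(U)\<close> are \<open>- w e\<^sup>T\<close> for the two unit vectors \<open>e\<close>.
\<close>

section \<open>Differentiation along lines\<close>

text \<open>
  The type \<open>real vec\<close> is not a normed space. Differentiability along all lines with a
  derivative that is linear in the direction is all that the chain rule for linear maps needs.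
\<close>

definition gateaux_differentiable :: "(real vec \<Rightarrow> real) \<Rightarrow> real vec \<Rightarrow> bool" where
  "gateaux_differentiable f U \<longleftrightarrow>
    (\<exists>g \<in> carrier_vec (dim_vec U). \<forall>W \<in> carrier_vec (dim_vec U).
      ((\<lambda>t. f (U + t \<cdot>\<^sub>v W)) has_real_derivative g \<bullet> W) (at 0))"

text \<open>Derivative rules at \<open>t = 0\<close> leave the base point in this form. It collapses
  to \<open>U\<close> only for equal dimensions, because a vector sum takes its dimension from the
  second summand.\<close>

lemma line_at_zero: "W \<in> carrier_vec (dim_vec U) \<Longrightarrow> U + 0 \<cdot>\<^sub>v W = (U :: real vec)"
  by (rule eq_vecI) auto

lemma gateaux_differentiable_const: "gateaux_differentiable (\<lambda>V. c) U"
  unfolding gateaux_differentiable_def by (rule bexI[of _ "0\<^sub>v (dim_vec U)"]) auto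

lemma gateaux_differentiable_index:
  assumes "k < dim_vec U"
  shows "gateaux_differentiable (\<lambda>V. V $ k) U"
proof -
  have "((\<lambda>t. (U + t \<cdot>\<^sub>v W) $ k) has_real_derivative unit_vec (dim_vec U) k \<bullet> W) (at 0)"
    if "W \<in> carrier_vec (dim_vec U)" for W
  proof -
    have "((\<lambda>t. U $ k + t * W $ k) has_real_derivative W $ k) (at 0)"
      by (auto intro!: derivative_eq_intros)
    moreover have "(\<lambda>t. (U + t \<cdot>\<^sub>v W) $ k) = (\<lambda>t. U $ k + t * W $ k)"
      using that assms by auto
    ultimately show ?thesis
      using that assms by simp
  qed
  then show ?thesis
    unfolding gateaux_differentiable_def by (metis unit_vec_carrier)
qed

lemma gateaux_differentiable_add:
  assumes "gateaux_differentiable f U" "gateaux_differentiable g U"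
  shows "gateaux_differentiable (\<lambda>V. f V + g V) U"
proof -
  obtain a b where c: "a \<in> carrier_vec (dim_vec U)" "b \<in> carrier_vec (dim_vec U)"
    and d: "\<And>W. W \<in> carrier_vec (dim_vec U) \<Longrightarrow>
        ((\<lambda>t. f (U + t \<cdot>\<^sub>v W)) has_real_derivative a \<bullet> W) (at 0)"
      "\<And>W. W \<in> carrier_vec (dim_vec U) \<Longrightarrow>
        ((\<lambda>t. g (U + t \<cdot>\<^sub>v W)) has_real_derivative b \<bullet> W) (at 0)"
    using assms unfolding gateaux_differentiable_def by blast
  show ?thesis
    unfolding gateaux_differentiable_def
  proof (intro bexI ballI)
    fix W :: "real vec" assume W: "W \<in> carrier_vec (dim_vec U)"
    show "((\<lambda>t. f (U + t \<cdot>\<^sub>v W) + g (U + t \<cdot>\<^sub>v W)) has_real_derivative (a + b) \<bullet> W) (at 0)"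
      using DERIV_add[OF d(1)[OF W] d(2)[OF W]] add_scalar_prod_distrib[OF c W] by simp
  qed (use c in simp)
qed

lemma gateaux_differentiable_mult:
  assumes "gateaux_differentiable f U" "gateaux_differentiable g U"
  shows "gateaux_differentiable (\<lambda>V. f V * g V) U"
proof -
  obtain a b where c: "a \<in> carrier_vec (dim_vec U)" "b \<in> carrier_vec (dim_vec U)"
    and d: "\<And>W. W \<in> carrier_vec (dim_vec U) \<Longrightarrow>
        ((\<lambda>t. f (U + t \<cdot>\<^sub>v W)) has_real_derivative a \<bullet> W) (at 0)"
      "\<And>W. W \<in> carrier_vec (dim_vec U) \<Longrightarrow>
        ((\<lambda>t. g (U + t \<cdot>\<^sub>v W)) has_real_derivative b \<bullet> W) (at 0)"
    using assms unfolding gateaux_differentiable_def by blast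
  show ?thesis
    unfolding gateaux_differentiable_def
  proof (intro bexI ballI)
    fix W :: "real vec" assume W: "W \<in> carrier_vec (dim_vec U)"
    \<comment> \<open>Leibniz rule for gradients: with gradients \<open>a\<close> and
      \<open>b\<close> of the factors, this combination is the gradient of the product.\<close>
    have "(g U \<cdot>\<^sub>v a + f U \<cdot>\<^sub>v b) \<bullet> W = (a \<bullet> W) * g U + (b \<bullet> W) * f U"
      using c W by (simp add: add_scalar_prod_distrib[of _ "dim_vec U"])
    then show "((\<lambda>t. f (U + t \<cdot>\<^sub>v W) * g (U + t \<cdot>\<^sub>v W)) has_real_derivative
        (g U \<cdot>\<^sub>v a + f U \<cdot>\<^sub>v b) \<bullet> W) (at 0)"
      using DERIV_mult[OF d(1)[OF W] d(2)[OF W]] by (simp add: line_at_zero[OF W])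
  qed (use c in simp)
qed

lemma gateaux_differentiable_inverse:
  assumes "gateaux_differentiable f U" "f U \<noteq> 0"
  shows "gateaux_differentiable (\<lambda>V. inverse (f V)) U"
proof -
  obtain a where c: "a \<in> carrier_vec (dim_vec U)"
    and d: "\<And>W. W \<in> carrier_vec (dim_vec U) \<Longrightarrow>
        ((\<lambda>t. f (U + t \<cdot>\<^sub>v W)) has_real_derivative a \<bullet> W) (at 0)"
    using assms unfolding gateaux_differentiable_def by blast
  show ?thesis
    unfolding gateaux_differentiable_def
  proof (intro bexI ballI)
    fix W :: "real vec" assume W: "W \<in> carrier_vec (dim_vec U)"
    have "f (U + 0 \<cdot>\<^sub>v W) \<noteq> 0"
      using assms(2) by (simp add: line_at_zero[OF W])
    \<comment> \<open>The gradient of 1/f is -a / f(U)^2, where \<open>a\<close> is the gradient of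
      f.\<close>
    moreover have "(- (inverse (f U) * inverse (f U)) \<cdot>\<^sub>v a) \<bullet> W =
        - (inverse (f U) * (a \<bullet> W) * inverse (f U))"
      using c W by simp
    ultimately show "((\<lambda>t. inverse (f (U + t \<cdot>\<^sub>v W))) has_real_derivative
        (- (inverse (f U) * inverse (f U)) \<cdot>\<^sub>v a) \<bullet> W) (at 0)"
      using DERIV_inverse'[OF d[OF W]] by (simp add: line_at_zero[OF W])
  qed (use c in simp)
qed

lemma gateaux_differentiable_divide:
  assumes "gateaux_differentiable f U" "gateaux_differentiable g U" "g U \<noteq> 0"
  shows "gateaux_differentiable (\<lambda>V. f V / g V) U"
  unfolding divide_inverse
  by (intro gateaux_differentiable_mult gateaux_differentiable_inverse assms)

lemma gateaux_differentiable_sum: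
  assumes "\<And>k. k \<in> K \<Longrightarrow> gateaux_differentiable (f k) U"
  shows "gateaux_differentiable (\<lambda>V. \<Sum>k\<in>K. f k V) U"
  using assms
  \<comment> \<open>Over an infinite index set the sum is 0 by convention, so that case, like the
    empty one, is the constant rule.\<close>
  by (induction K rule: infinite_finite_induct)
    (auto intro!: gateaux_differentiable_const gateaux_differentiable_add)

lemmas gateaux_differentiable_intros =
  gateaux_differentiable_const gateaux_differentiable_index gateaux_differentiable_add
  gateaux_differentiable_mult gateaux_differentiable_divide gateaux_differentiable_sum

section \<open>Jacobian matrices and directional derivatives\<close>

lemma jacobian_carrier: "jacobian F U \<in> carrier_mat (dim_vec (F U)) (dim_vec U)"
  by (simp add: jacobian_def)

text \<open>The Jacobian records derivatives in coordinate directions only. Testing the gradient g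
  on unit vectors identifies it with row i of the Jacobian, and linearity of the derivative in the
  direction then gives every \<open>W\<close>.\<close>

lemma has_derivative_jacobian:
  assumes "gateaux_differentiable (\<lambda>V. F V $ i) U"
    and "i < dim_vec (F U)" "W \<in> carrier_vec (dim_vec U)"
  shows "((\<lambda>t. F (U + t \<cdot>\<^sub>v W) $ i) has_real_derivative (jacobian F U *\<^sub>v W) $ i) (at 0)"
proof -
  obtain g where g: "g \<in> carrier_vec (dim_vec U)"
    and d: "\<And>W. W \<in> carrier_vec (dim_vec U) \<Longrightarrow>
        ((\<lambda>t. F (U + t \<cdot>\<^sub>v W) $ i) has_real_derivative g \<bullet> W) (at 0)"
    using assms unfolding gateaux_differentiable_def by blast
  have "row (jacobian F U) i = g"
  proof (rule eq_vecI)
    fix j assume "j < dim_vec g"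
    then have j: "j < dim_vec U"
      using g by simp
    then show "row (jacobian F U) i $ j = g $ j"
      using DERIV_imp_deriv[OF d[OF unit_vec_carrier], of j] g assms(2)
      by (simp add: jacobian_def)
  qed (use g in \<open>simp add: jacobian_def\<close>)
  then show ?thesis
    using d[OF assms(3)] assms(2) by (simp add: jacobian_def)
qed

section \<open>Block diagonal matrices acting on vectors\<close>

lemma diag_block_mat_Cons_mult_vec:
  assumes "B \<in> carrier_mat m m" "diag_block_mat Bs \<in> carrier_mat d d" "W \<in> carrier_vec (m + d)"
  shows "diag_block_mat (B # Bs) *\<^sub>v W =
    (B *\<^sub>v vec_first W m) @\<^sub>v (diag_block_mat Bs *\<^sub>v vec_last W d)"
proof -
  have "diag_block_mat (B # Bs) *\<^sub>v W =
      four_block_mat B (0\<^sub>m m d) (0\<^sub>m d m) (diag_block_mat Bs) *\<^sub>v (vec_first W m @\<^sub>v vec_last W d)"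
    using assms by (simp add: Let_def)
  also have "\<dots> = (B *\<^sub>v vec_first W m) @\<^sub>v (diag_block_mat Bs *\<^sub>v vec_last W d)"
    using assms by (subst four_block_mat_mult_vec[of _ m m _ d _ d]) auto
  finally show ?thesis .
qed

text \<open>Component \<open>2 * q + r\<close> is row r of block q. The induction peels off the
  first block: q = 0 lies in it, and any other q becomes q - 1 in the tail of \<open>W\<close>,
  which is why both vary in the induction.\<close>

lemma diag_block_replicate_mult_vec:
  assumes "A \<in> carrier_mat 2 2" "W \<in> carrier_vec (k * 2)" "q < k" "r < 2"
  shows "(diag_block_mat (replicate k A) *\<^sub>v W) $ (2 * q + r) =
    A $$ (r, 0) * W $ (2 * q) + A $$ (r, 1) * W $ (2 * q + 1)"
  using assms(2,3)
proof (induction k arbitrary: q W)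
  case (Suc k)
  let ?D = "diag_block_mat (replicate k A)"
  have D: "?D \<in> carrier_mat (k * 2) (k * 2)"
    by (rule diag_block_replicate_carrier[OF assms(1)])
  have W: "W \<in> carrier_vec (2 + k * 2)"
    using Suc.prems by simp
  have eq: "diag_block_mat (replicate (Suc k) A) *\<^sub>v W =
      (A *\<^sub>v vec_first W 2) @\<^sub>v (?D *\<^sub>v vec_last W (k * 2))"
    unfolding replicate_Suc by (rule diag_block_mat_Cons_mult_vec[OF assms(1) D W])
  show ?case
  proof (cases q)
    case 0
    then show ?thesis
      unfolding eq using assms(1,4) D W
      by (simp add: scalar_prod_def vec_first_def numeral_2_eq_2)
  next
    case (Suc p)
    have "(?D *\<^sub>v vec_last W (k * 2)) $ (2 * p + r) =
        A $$ (r, 0) * vec_last W (k * 2) $ (2 * p) + A $$ (r, 1) * vec_last W (k * 2) $ (2 * p + 1)"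
      using Suc Suc.prems by (intro Suc.IH) auto
    then show ?thesis
      unfolding eq using assms(1,4) D W Suc \<open>q < Suc k\<close>
      by (simp add: vec_last_def)
  qed
qed simp

text \<open>One formula for both block shapes in use: the head block has size m = 1 for the rotation
  and m = 3 for the nonconservative matrices.\<close>

lemma diag_block_Cons_replicate_mult_vec:
  assumes "B \<in> carrier_mat m m" "A \<in> carrier_mat 2 2" "W \<in> carrier_vec (m + k * 2)"
  shows "i < m \<Longrightarrow>
      (diag_block_mat (B # replicate k A) *\<^sub>v W) $ i = (B *\<^sub>v vec_first W m) $ i"
    and "q < k \<Longrightarrow> r < 2 \<Longrightarrow> (diag_block_mat (B # replicate k A) *\<^sub>v W) $ (m + (2 * q + r)) =
      A $$ (r, 0) * W $ (m + 2 * q) + A $$ (r, 1) * W $ (m + 2 * q + 1)"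
proof -
  let ?D = "diag_block_mat (replicate k A)"
  have D: "?D \<in> carrier_mat (k * 2) (k * 2)"
    by (rule diag_block_replicate_carrier[OF assms(2)])
  have eq: "diag_block_mat (B # replicate k A) *\<^sub>v W =
      (B *\<^sub>v vec_first W m) @\<^sub>v (?D *\<^sub>v vec_last W (k * 2))"
    by (rule diag_block_mat_Cons_mult_vec[OF assms(1) D assms(3)])
  show "(diag_block_mat (B # replicate k A) *\<^sub>v W) $ i = (B *\<^sub>v vec_first W m) $ i" if "i < m"
    unfolding eq using that assms(1) D by simp
  show "(diag_block_mat (B # replicate k A) *\<^sub>v W) $ (m + (2 * q + r)) =
      A $$ (r, 0) * W $ (m + 2 * q) + A $$ (r, 1) * W $ (m + 2 * q + 1)" if "q < k" "r < 2"
  proof -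
    have "(?D *\<^sub>v vec_last W (k * 2)) $ (2 * q + r) =
        A $$ (r, 0) * vec_last W (k * 2) $ (2 * q) + A $$ (r, 1) * vec_last W (k * 2) $ (2 * q + 1)"
      by (rule diag_block_replicate_mult_vec[OF assms(2) _ that]) simp
    then show ?thesis
      unfolding eq using assms(1,3) D that by (simp add: vec_last_def add.assoc)
  qed
qed

text \<open>After the leading 1 each consecutive pair is rotated by \<open>rot2\<close>. Pair j = 0
  is the momentum \<open>(h u_m, h v_m)\<close>, the pairs j = 1..N are the moments, so one formula
  serves both.\<close>

lemma rotation_mult_vec:
  assumes "W \<in> carrier_vec (2 * N + 3)"
  shows "(rotation N \<theta> *\<^sub>v W) $ 0 = W $ 0"
    and "j \<le> N \<Longrightarrow>
      (rotation N \<theta> *\<^sub>v W) $ (2 * j + 1) = cos \<theta> * W $ (2 * j + 1) + sin \<theta> * W $ (2 * j + 2)"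
    and "j \<le> N \<Longrightarrow>
      (rotation N \<theta> *\<^sub>v W) $ (2 * j + 2) = - sin \<theta> * W $ (2 * j + 1) + cos \<theta> * W $ (2 * j + 2)"
proof -
  have "2 * N + 3 = 1 + (N + 1) * 2"
    by simp
  then have W: "W \<in> carrier_vec (1 + (N + 1) * 2)"
    using assms by metis
  note block = diag_block_Cons_replicate_mult_vec[OF one_carrier_mat rot2_carrier W]
  show "(rotation N \<theta> *\<^sub>v W) $ 0 = W $ 0"
    unfolding rotation_def using block(1)[of 0] W by (simp add: vec_first_def)
  show "(rotation N \<theta> *\<^sub>v W) $ (2 * j + 1) = cos \<theta> * W $ (2 * j + 1) + sin \<theta> * W $ (2 * j + 2)"
    if "j \<le> N"
    using block(2)[of j 0 \<theta>] that by (simp add: rotation_def rot2_def mat_of_rows_list_def)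
  show "(rotation N \<theta> *\<^sub>v W) $ (2 * j + 2) = - sin \<theta> * W $ (2 * j + 1) + cos \<theta> * W $ (2 * j + 2)"
    if "j \<le> N"
    using block(2)[of j 1 \<theta>] that by (simp add: rotation_def rot2_def mat_of_rows_list_def)
qed

lemma blocks_carrier:
  assumes "A \<in> carrier_mat 2 2"
  shows "diag_block_mat (0\<^sub>m 3 3 # replicate N A) \<in> carrier_mat (2 * N + 3) (2 * N + 3)"
proof -
  have "diag_block_mat (0\<^sub>m 3 3 # replicate N A) \<in> carrier_mat (3 + N * 2) (3 + N * 2)"
    unfolding diag_block_mat.simps Let_def
    by (intro four_block_carrier_mat zero_carrier_mat diag_block_replicate_carrier assms)
  moreover have "3 + N * 2 = 2 * N + 3"
    by simp
  ultimately show ?thesis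
    by metis
qed

lemma blocks_mult_vec:
  assumes "A \<in> carrier_mat 2 2" "W \<in> carrier_vec (2 * N + 3)"
  shows "i < 3 \<Longrightarrow> (diag_block_mat (0\<^sub>m 3 3 # replicate N A) *\<^sub>v W) $ i = 0"
    and "j \<in> {1..N} \<Longrightarrow> (diag_block_mat (0\<^sub>m 3 3 # replicate N A) *\<^sub>v W) $ (2 * j + 1) =
      A $$ (0, 0) * W $ (2 * j + 1) + A $$ (0, 1) * W $ (2 * j + 2)"
    and "j \<in> {1..N} \<Longrightarrow> (diag_block_mat (0\<^sub>m 3 3 # replicate N A) *\<^sub>v W) $ (2 * j + 2) =
      A $$ (1, 0) * W $ (2 * j + 1) + A $$ (1, 1) * W $ (2 * j + 2)"
proof -
  have "2 * N + 3 = 3 + N * 2"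
    by simp
  then have W: "W \<in> carrier_vec (3 + N * 2)"
    using assms by metis
  note block = diag_block_Cons_replicate_mult_vec[OF zero_carrier_mat assms(1) W]
  show "(diag_block_mat (0\<^sub>m 3 3 # replicate N A) *\<^sub>v W) $ i = 0" if "i < 3"
    using block(1)[OF that] that W by simp
  show "(diag_block_mat (0\<^sub>m 3 3 # replicate N A) *\<^sub>v W) $ (2 * j + 1) =
      A $$ (0, 0) * W $ (2 * j + 1) + A $$ (0, 1) * W $ (2 * j + 2)" if "j \<in> {1..N}"
  proof -
    \<comment> \<open>Blocks are counted from 0 behind the three leading components: block q = j - 1
      starts at 3 + 2 q = 2 j + 1.\<close>
    obtain q where "j = Suc q"
      using \<open>j \<in> {1..N}\<close> by (cases j) auto
    then show ?thesis
      using block(2)[of q 0] that by (simp add: eval_nat_numeral)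
  qed
  show "(diag_block_mat (0\<^sub>m 3 3 # replicate N A) *\<^sub>v W) $ (2 * j + 2) =
      A $$ (1, 0) * W $ (2 * j + 1) + A $$ (1, 1) * W $ (2 * j + 2)" if "j \<in> {1..N}"
  proof -
    obtain q where "j = Suc q"
      using \<open>j \<in> {1..N}\<close> by (cases j) auto
    then show ?thesis
      using block(2)[of q 1] that by (simp add: eval_nat_numeral)
  qed
qed

section \<open>The fluxes\<close>

lemma index_cases:
  fixes i N :: nat
  assumes "i < 2 * N + 3"
  obtains "i = 0" | "i = 1" | "i = 2"
    | j where "j \<in> {1..N}" "i = 2 * j + 1" | j where "j \<in> {1..N}" "i = 2 * j + 2"
proof -
  \<comment> \<open>First split by parity alone, with j = 0 allowed; the momentum components 1 and 2
    are then separated as the case j = 0.\<close>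
  consider "i = 0" | j where "j \<le> N" "i = 2 * j + 1" | j where "j \<le> N" "i = 2 * j + 2"
  proof (cases "i = 0")
    case False
    then have "i = 2 * ((i - 1) div 2) + 1 \<or> i = 2 * ((i - 1) div 2) + 2" "(i - 1) div 2 \<le> N"
      using assms by presburger+
    then show ?thesis
      using that by blast
  qed (use that in blast)
  then show thesis
  proof cases
    case (2 j)
    then show ?thesis
      using that(2) that(4)[of j] by (cases "j = 0") auto
  next
    case (3 j)
    then show ?thesis
      using that(3) that(5)[of j] by (cases "j = 0") auto
  qed (use that(1) in simp)
qed

lemma nth_concat_pairs:
  assumes "j < length xs"
  shows "concat (map (\<lambda>x. [f x, g x]) xs) ! (2 * j) = f (xs ! j)"
    and "concat (map (\<lambda>x. [f x, g x]) xs) ! (2 * j + 1) = g (xs ! j)"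
  using assms
  by (induction xs arbitrary: j) (auto simp: nth_Cons' less_Suc_eq_0_disj)

text \<open>The common layout of the two fluxes, with abstract entries, so that both are read off
  componentwise in the same way.\<close>

lemma vec_of_list_concat_pairs:
  fixes f g :: "nat \<Rightarrow> real" and a b c :: real and N :: nat
  defines "V \<equiv> vec_of_list ([a, b, c] @ concat (map (\<lambda>j. [f j, g j]) [1..<N + 1]))"
  shows "dim_vec V = 2 * N + 3" "V $ 0 = a" "V $ 1 = b" "V $ 2 = c"
    "j \<in> {1..N} \<Longrightarrow> V $ (2 * j + 1) = f j" "j \<in> {1..N} \<Longrightarrow> V $ (2 * j + 2) = g j"
proof -
  show "dim_vec V = 2 * N + 3"
    unfolding V_def by (simp add: length_concat sum_list_triv comp_def)
  show "V $ 0 = a" "V $ 1 = b" "V $ 2 = c"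
    unfolding V_def vec_of_list_index by simp_all
  have *: "V $ (2 * j + 1) = f j" "V $ (2 * j + 2) = g j" if j: "j \<in> {1..N}"
  proof -
    \<comment> \<open>The list \<open>[1..<N + 1]\<close> is indexed from 0, so moment j sits at
      position q = j - 1, behind the three leading entries.\<close>
    obtain q where q: "j = Suc q"
      using j by (cases j) auto
    have "q < length [1..<N + 1]"
      using j q by simp
    from nth_concat_pairs[OF this, of f g]
    show "V $ (2 * j + 1) = f j" "V $ (2 * j + 2) = g j"
      using j q unfolding V_def vec_of_list_index
      by (simp_all add: numeral_3_eq_3 del: upt_Suc)
  qed
  show "j \<in> {1..N} \<Longrightarrow> V $ (2 * j + 1) = f j" "j \<in> {1..N} \<Longrightarrow> V $ (2 * j + 2) = g j"
    using * by auto
qed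

lemma flux_x_index:
  shows "dim_vec (flux_x N G U) = 2 * N + 3"
    and "flux_x N G U $ 0 = height U * u_mean U"
    and "flux_x N G U $ 1 = height U * ((u_mean U)\<^sup>2 +
      (\<Sum>j = 1..N. (alpha U j)\<^sup>2 / real (2 * j + 1))) + 1 / 2 * G * (height U)\<^sup>2"
    and "flux_x N G U $ 2 = height U * (u_mean U * v_mean U +
      (\<Sum>j = 1..N. alpha U j * beta U j / real (2 * j + 1)))"
    and "j \<in> {1..N} \<Longrightarrow> flux_x N G U $ (2 * j + 1) = 2 * height U * u_mean U * alpha U j"
    and "j \<in> {1..N} \<Longrightarrow> flux_x N G U $ (2 * j + 2) =
      height U * (u_mean U * beta U j + v_mean U * alpha U j)"
  unfolding flux_x_def Let_def by (simp_all only: vec_of_list_concat_pairs)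

lemma flux_y_index:
  shows "dim_vec (flux_y N G U) = 2 * N + 3"
    and "flux_y N G U $ 0 = height U * v_mean U"
    and "flux_y N G U $ 1 = height U * (u_mean U * v_mean U +
      (\<Sum>j = 1..N. alpha U j * beta U j / real (2 * j + 1)))"
    and "flux_y N G U $ 2 = height U * ((v_mean U)\<^sup>2 +
      (\<Sum>j = 1..N. (beta U j)\<^sup>2 / real (2 * j + 1))) + 1 / 2 * G * (height U)\<^sup>2"
    and "j \<in> {1..N} \<Longrightarrow> flux_y N G U $ (2 * j + 1) =
      height U * (u_mean U * beta U j + v_mean U * alpha U j)"
    and "j \<in> {1..N} \<Longrightarrow> flux_y N G U $ (2 * j + 2) = 2 * height U * v_mean U * beta U j"
  unfolding flux_y_def Let_def by (simp_all only: vec_of_list_concat_pairs)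

text \<open>Each component is built from coordinates and constants by sums, products and quotients
  with denominators h or 2 j + 1. Here h is nonzero because U lies in the state space; what remains
  is that all coordinate indices are in range.\<close>

lemma gateaux_differentiable_flux:
  assumes "U \<in> state_space N" "i < 2 * N + 3"
  shows "gateaux_differentiable (\<lambda>V. flux_x N G V $ i) U"
    and "gateaux_differentiable (\<lambda>V. flux_y N G V $ i) U"
proof -
  have U: "dim_vec U = 2 * N + 3" "U $ 0 \<noteq> 0"
    using assms(1) by (auto simp: state_space_def height_def)
  note defs = height_def u_mean_def v_mean_def alpha_def beta_def power2_eq_square
  show "gateaux_differentiable (\<lambda>V. flux_x N G V $ i) U"
    using assms(2)
    by (cases i rule: index_cases; simp only: flux_x_index defs;
        intro gateaux_differentiable_intros; use U in \<open>auto; presburger\<close>)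
  show "gateaux_differentiable (\<lambda>V. flux_y N G V $ i) U"
    using assms(2)
    by (cases i rule: index_cases; simp only: flux_y_index defs;
        intro gateaux_differentiable_intros; use U in \<open>auto; presburger\<close>)
qed

section \<open>Rotational invariance\<close>

text \<open>The height is invariant, so dividing by it turns the rotation of the component pairs
  into the same rotation of \<open>(u_m, v_m)\<close> and of each
  \<open>(\<alpha>_j, \<beta>_j)\<close>.\<close>

lemma rotated_state:
  assumes "U \<in> carrier_vec (2 * N + 3)"
  shows "height (rotation N \<theta> *\<^sub>v U) = height U"
    and "u_mean (rotation N \<theta> *\<^sub>v U) = cos \<theta> * u_mean U + sin \<theta> * v_mean U"
    and "v_mean (rotation N \<theta> *\<^sub>v U) = - sin \<theta> * u_mean U + cos \<theta> * v_mean U"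
    and "j \<in> {1..N} \<Longrightarrow>
      alpha (rotation N \<theta> *\<^sub>v U) j = cos \<theta> * alpha U j + sin \<theta> * beta U j"
    and "j \<in> {1..N} \<Longrightarrow>
      beta (rotation N \<theta> *\<^sub>v U) j = - sin \<theta> * alpha U j + cos \<theta> * beta U j"
  using rotation_mult_vec[OF assms, where \<theta> = \<theta>]
    rotation_mult_vec(2,3)[OF assms, where j = 0 and \<theta> = \<theta>]
  by (simp_all add: height_def u_mean_def v_mean_def alpha_def beta_def add_divide_distrib
      diff_divide_distrib numeral_2_eq_2)

lemma rotation_mult_vec_carrier:
  "W \<in> carrier_vec (2 * N + 3) \<Longrightarrow> rotation N \<theta> *\<^sub>v W \<in> carrier_vec (2 * N + 3)"
  using rotation_carrier mult_mat_vec_carrier by blast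

text \<open>Rewrite rules that eliminate squares of the sine and so normalize polynomials in sine
  and cosine; the second form catches a square inside a right-nested product.\<close>

lemma sin_mult_sin:
  fixes x :: real
  shows "sin x * sin x = 1 - cos x * cos x"
    and "sin x * (sin x * y) = y - cos x * (cos x * y)"
proof -
  show *: "sin x * sin x = 1 - cos x * cos x"
    using sin_cos_squared_add[of x] by (simp add: power2_eq_square)
  show "sin x * (sin x * y) = y - cos x * (cos x * y)"
    unfolding mult.assoc[symmetric] * by (simp add: algebra_simps)
qed

text \<open>Quotients by h = 0 are 0 by convention, so the identity is available at every vector of
  the right dimension, hence along a whole line \<open>U + t W\<close> even where it leaves the
  state space.\<close>

lemma flux_rotation:
  assumes "U \<in> carrier_vec (2 * N + 3)"
  shows "cos \<theta> \<cdot>\<^sub>v flux_x N G U + sin \<theta> \<cdot>\<^sub>v flux_y N G U =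
    rotation N (- \<theta>) *\<^sub>v flux_x N G (rotation N \<theta> *\<^sub>v U)" (is "?L = ?R")
proof (rule eq_vecI)
  show "dim_vec ?L = dim_vec ?R"
    using rotation_carrier[of N "- \<theta>"] by (simp add: flux_y_index(1))
  fix i assume "i < dim_vec ?R"
  then have i: "i < 2 * N + 3"
    using rotation_carrier[of N "- \<theta>"] by simp
  have F: "flux_x N G (rotation N \<theta> *\<^sub>v U) \<in> carrier_vec (2 * N + 3)"
    by (rule carrier_vecI) (rule flux_x_index)
  have L: "?L $ i = cos \<theta> * flux_x N G U $ i + sin \<theta> * flux_y N G U $ i"
    using i by (simp add: flux_x_index(1) flux_y_index(1))
  define h u v a b where "h = height U" and "u = u_mean U" and "v = v_mean U"
    and "a = alpha U" and "b = beta U"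
  define c s where "c = cos \<theta>" and "s = sin \<theta>"
  note ss = sin_mult_sin[of \<theta>, folded c_def s_def]
  \<comment> \<open>These are the entries of the symmetric tensor S, the sum of
    \<open>a_j a_j^T / (2 j + 1)\<close>. Rotating the state replaces S by
    \<open>T_2 S T_2^T\<close>; the x-flux contains its first column, computed in
    \<open>saa'\<close> and \<open>sab'\<close>.\<close>
  define saa sab sbb where "saa = (\<Sum>j = 1..N. (a j)\<^sup>2 / real (2 * j + 1))"
    and "sab = (\<Sum>j = 1..N. a j * b j / real (2 * j + 1))"
    and "sbb = (\<Sum>j = 1..N. (b j)\<^sup>2 / real (2 * j + 1))"
  let ?U = "rotation N \<theta> *\<^sub>v U"
  have saa': "(\<Sum>j = 1..N. (alpha ?U j)\<^sup>2 / real (2 * j + 1)) = c\<^sup>2 * saa + 2 * c * s * sab + s\<^sup>2 * sbb"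
  proof -
    have "(\<Sum>j = 1..N. (alpha ?U j)\<^sup>2 / real (2 * j + 1)) =
        (\<Sum>j = 1..N. c\<^sup>2 * ((a j)\<^sup>2 / real (2 * j + 1)) + 2 * c * s * (a j * b j / real (2 * j + 1))
          + s\<^sup>2 * ((b j)\<^sup>2 / real (2 * j + 1)))"
      by (rule sum.cong)
        (simp_all add: rotated_state[OF assms] a_def b_def c_def s_def power2_eq_square
          algebra_simps add_divide_distrib diff_divide_distrib)
    then show ?thesis
      by (simp only: sum.distrib sum_distrib_left saa_def sab_def sbb_def)
  qed
  have sab': "(\<Sum>j = 1..N. alpha ?U j * beta ?U j / real (2 * j + 1)) =
      - c * s * saa + (c\<^sup>2 - s\<^sup>2) * sab + c * s * sbb"
  proof -
    have "(\<Sum>j = 1..N. alpha ?U j * beta ?U j / real (2 * j + 1)) =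
        (\<Sum>j = 1..N. - c * s * ((a j)\<^sup>2 / real (2 * j + 1))
          + (c\<^sup>2 - s\<^sup>2) * (a j * b j / real (2 * j + 1))
          + c * s * ((b j)\<^sup>2 / real (2 * j + 1)))"
      by (rule sum.cong)
        (simp_all add: rotated_state[OF assms] a_def b_def c_def s_def power2_eq_square
          algebra_simps add_divide_distrib diff_divide_distrib)
    then show ?thesis
      by (simp only: sum.distrib sum_distrib_left saa_def sab_def sbb_def)
  qed
  note rot = rotation_mult_vec[OF F, where \<theta> = "- \<theta>", unfolded cos_minus sin_minus minus_minus,
      folded c_def s_def]
  note state = rotated_state[OF assms, where \<theta> = \<theta>, folded h_def u_def v_def a_def b_def c_def s_def]
  note Fx = flux_x_index[where N = N and G = G and U = ?U, unfolded saa' sab' state(1-3)]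
  note Fx0 = flux_x_index[where N = N and G = G and U = U,
      folded h_def u_def v_def a_def b_def, folded saa_def sab_def sbb_def]
  note Fy0 = flux_y_index[where N = N and G = G and U = U,
      folded h_def u_def v_def a_def b_def, folded saa_def sab_def sbb_def]
  show "?L $ i = ?R $ i"
    using i
  proof (cases i rule: index_cases)
    case 1
    then show ?thesis
      unfolding L
      unfolding c_def[symmetric] s_def[symmetric]
      by (simp only: rot Fx Fx0 Fy0) (simp add: algebra_simps)
  next
    case 2
    \<comment> \<open>Components 1 and 2 form pair j = 0. The pressure depends on h alone and sits
      in component 1 of the x-flux, so rotating back yields c times it here and s times it in the
      next case, as on the left.\<close>
    have R: "?R $ i = c * flux_x N G ?U $ 1 - s * flux_x N G ?U $ 2"
      using rot(2)[of 0] 2 by (simp add: numeral_2_eq_2)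
    show ?thesis
      unfolding L R
      unfolding c_def[symmetric] s_def[symmetric] 2 Fx Fx0 Fy0
      by (simp add: power2_eq_square algebra_simps ss)
  next
    case 3
    have R: "?R $ i = s * flux_x N G ?U $ 1 + c * flux_x N G ?U $ 2"
      using rot(3)[of 0] 3 by (simp add: numeral_2_eq_2)
    show ?thesis
      unfolding L R
      unfolding c_def[symmetric] s_def[symmetric] 3 Fx Fx0 Fy0
      by (simp add: power2_eq_square algebra_simps ss)
  next
    case (4 j)
    \<comment> \<open>Moment pair j of the two fluxes gives the two columns of
      \<open>h (w a_j^T + a_j w^T)\<close>, which transforms like S.\<close>
    have R: "?R $ i = c * flux_x N G ?U $ (2 * j + 1) - s * flux_x N G ?U $ (2 * j + 2)"
      using rot(2)[of j] 4 by simp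
    show ?thesis
      unfolding L R
      unfolding c_def[symmetric] s_def[symmetric] 4(2) Fx(5,6)[OF 4(1)] Fx0(5,6)[OF 4(1)]
        Fy0(5,6)[OF 4(1)] state(4,5)[OF 4(1)]
      by (simp add: power2_eq_square algebra_simps ss)
  next
    case (5 j)
    have R: "?R $ i = s * flux_x N G ?U $ (2 * j + 1) + c * flux_x N G ?U $ (2 * j + 2)"
      using rot(3)[of j] 5 by simp
    show ?thesis
      unfolding L R
      unfolding c_def[symmetric] s_def[symmetric] 5(2) Fx(5,6)[OF 5(1)] Fx0(5,6)[OF 5(1)]
        Fy0(5,6)[OF 5(1)] state(4,5)[OF 5(1)]
      by (simp add: power2_eq_square algebra_simps ss)
  qed
qed

section \<open>The flux identity differentiated\<close>

lemma rotation_state_space: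
  "U \<in> state_space N \<Longrightarrow> rotation N \<theta> *\<^sub>v U \<in> state_space N"
  by (simp add: state_space_def rotated_state rotation_mult_vec_carrier)

text \<open>Component i of either side is the derivative at t = 0 of the same scalar function,
  namely component i of the flux identity along \<open>U + t W\<close>; derivatives are
  unique.\<close>

lemma jacobian_rotation:
  assumes U: "U \<in> state_space N" and W: "W \<in> carrier_vec (2 * N + 3)"
  shows "cos \<theta> \<cdot>\<^sub>v (jacobian (flux_x N G) U *\<^sub>v W) + sin \<theta> \<cdot>\<^sub>v (jacobian (flux_y N G) U *\<^sub>v W) =
    rotation N (- \<theta>) *\<^sub>v (jacobian (flux_x N G) (rotation N \<theta> *\<^sub>v U) *\<^sub>v (rotation N \<theta> *\<^sub>v W))"
    (is "?L = ?M *\<^sub>v (?J *\<^sub>v (?T *\<^sub>v W))")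
proof (rule eq_vecI)
  have Uc: "U \<in> carrier_vec (2 * N + 3)"
    using U by (simp add: state_space_def)
  have M: "dim_row ?M = 2 * N + 3" "dim_col ?M = 2 * N + 3"
    using rotation_carrier[of N "- \<theta>"] by auto
  show "dim_vec ?L = dim_vec (?M *\<^sub>v (?J *\<^sub>v (?T *\<^sub>v W)))"
    using M by (simp add: jacobian_def flux_y_index(1))
  fix i assume "i < dim_vec (?M *\<^sub>v (?J *\<^sub>v (?T *\<^sub>v W)))"
  then have i: "i < 2 * N + 3"
    using M by simp
  \<comment> \<open>A row of the constant matrix acts as a finite sum with constant coefficients,
    through which the derivative passes termwise.\<close>
  have mult: "(?M *\<^sub>v V) $ i = (\<Sum>k<2 * N + 3. ?M $$ (i, k) * V $ k)" if "dim_vec V = 2 * N + 3" for V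
    using i M that by (auto simp: scalar_prod_def atLeast0LessThan intro!: sum.cong)
  \<comment> \<open>By linearity the line through U in direction W becomes the line through T U in
    direction T W, which is all of the chain rule required here.\<close>
  have line: "?T *\<^sub>v (U + t \<cdot>\<^sub>v W) = ?T *\<^sub>v U + t \<cdot>\<^sub>v (?T *\<^sub>v W)" for t
    using Uc W rotation_carrier[of N \<theta>] by (simp add: mult_add_distrib_mat_vec mult_mat_vec)
  have dim: "dim_vec (?T *\<^sub>v U) = 2 * N + 3"
    by (rule carrier_vecD[OF rotation_mult_vec_carrier[OF Uc]])
  have "((\<lambda>t. (?M *\<^sub>v flux_x N G (?T *\<^sub>v U + t \<cdot>\<^sub>v (?T *\<^sub>v W))) $ i) has_real_derivative
      (?M *\<^sub>v (?J *\<^sub>v (?T *\<^sub>v W))) $ i) (at 0)"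
  proof -
    have "((\<lambda>t. \<Sum>k<2 * N + 3. ?M $$ (i, k) * flux_x N G (?T *\<^sub>v U + t \<cdot>\<^sub>v (?T *\<^sub>v W)) $ k)
        has_real_derivative (\<Sum>k<2 * N + 3. ?M $$ (i, k) * (?J *\<^sub>v (?T *\<^sub>v W)) $ k)) (at 0)"
    proof (intro DERIV_sum DERIV_cmult has_derivative_jacobian)
      fix k assume "k \<in> {..<2 * N + 3}"
      then show "gateaux_differentiable (\<lambda>V. flux_x N G V $ k) (?T *\<^sub>v U)"
        "k < dim_vec (flux_x N G (?T *\<^sub>v U))"
        using gateaux_differentiable_flux(1)[OF rotation_state_space[OF U]]
        by (simp_all add: flux_x_index(1))
      show "?T *\<^sub>v W \<in> carrier_vec (dim_vec (?T *\<^sub>v U))"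
        unfolding dim by (rule rotation_mult_vec_carrier[OF W])
    qed
    moreover have "dim_vec (?J *\<^sub>v (?T *\<^sub>v W)) = 2 * N + 3"
      by (simp add: jacobian_def flux_x_index(1))
    ultimately show ?thesis
      by (simp only: mult flux_x_index(1))
  qed
  moreover have "(?M *\<^sub>v flux_x N G (?T *\<^sub>v U + t \<cdot>\<^sub>v (?T *\<^sub>v W))) $ i =
      cos \<theta> * flux_x N G (U + t \<cdot>\<^sub>v W) $ i + sin \<theta> * flux_y N G (U + t \<cdot>\<^sub>v W) $ i" for t
    using flux_rotation[of "U + t \<cdot>\<^sub>v W" N \<theta> G] Uc W i
    by (simp add: line[symmetric] flux_x_index(1) flux_y_index(1) flip: flux_rotation)
  ultimately have "((\<lambda>t. cos \<theta> * flux_x N G (U + t \<cdot>\<^sub>v W) $ i + sin \<theta> * flux_y N G (U + t \<cdot>\<^sub>v W) $ i)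
      has_real_derivative (?M *\<^sub>v (?J *\<^sub>v (?T *\<^sub>v W))) $ i) (at 0)"
    by simp
  moreover have "((\<lambda>t. cos \<theta> * flux_x N G (U + t \<cdot>\<^sub>v W) $ i + sin \<theta> * flux_y N G (U + t \<cdot>\<^sub>v W) $ i)
      has_real_derivative ?L $ i) (at 0)"
  proof -
    have "?L $ i = cos \<theta> * (jacobian (flux_x N G) U *\<^sub>v W) $ i
        + sin \<theta> * (jacobian (flux_y N G) U *\<^sub>v W) $ i"
      using i by (simp add: jacobian_def flux_x_index(1) flux_y_index(1))
    moreover have "W \<in> carrier_vec (dim_vec U)"
      using Uc W by simp
    ultimately show ?thesis
      using gateaux_differentiable_flux[OF U i] i
      by (auto intro!: DERIV_add DERIV_cmult has_derivative_jacobian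
          simp: flux_x_index(1) flux_y_index(1))
  qed
  ultimately show "?L $ i = (?M *\<^sub>v (?J *\<^sub>v (?T *\<^sub>v W))) $ i"
    using DERIV_unique by blast
qed

section \<open>Nonconservative products\<close>

lemma block_carrier: "p_block U \<in> carrier_mat 2 2" "q_block U \<in> carrier_mat 2 2"
  by (auto simp: p_block_def q_block_def mat_of_rows_list_def)

lemma noncons_carrier:
  "P_noncons N U \<in> carrier_mat (2 * N + 3) (2 * N + 3)"
  "Q_noncons N U \<in> carrier_mat (2 * N + 3) (2 * N + 3)"
  unfolding P_noncons_def Q_noncons_def by (intro blocks_carrier block_carrier)+

text \<open>Blockwise, \<open>p(T U) = - (T_2 w) e_1^T\<close>. Since
  \<open>T_2^-1 T_2 w = w\<close> and \<open>e_1^T T_2 = (cos \<theta>, sin \<theta>)\<close>,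
  conjugation gives \<open>- w (cos \<theta>, sin \<theta>)\<close>, which is
  \<open>cos \<theta> p(U) + sin \<theta> q(U)\<close>.\<close>

lemma noncons_rotation:
  assumes U: "U \<in> carrier_vec (2 * N + 3)" and W: "W \<in> carrier_vec (2 * N + 3)"
  shows "cos \<theta> \<cdot>\<^sub>v (P_noncons N U *\<^sub>v W) + sin \<theta> \<cdot>\<^sub>v (Q_noncons N U *\<^sub>v W) =
    rotation N (- \<theta>) *\<^sub>v (P_noncons N (rotation N \<theta> *\<^sub>v U) *\<^sub>v (rotation N \<theta> *\<^sub>v W))" (is "?L = ?R")
proof (rule eq_vecI)
  let ?U = "rotation N \<theta> *\<^sub>v U" and ?W = "rotation N \<theta> *\<^sub>v W"
  have W': "?W \<in> carrier_vec (2 * N + 3)"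
    by (rule rotation_mult_vec_carrier[OF W])
  have PW: "P_noncons N ?U *\<^sub>v ?W \<in> carrier_vec (2 * N + 3)"
    using noncons_carrier W' mult_mat_vec_carrier by blast
  show "dim_vec ?L = dim_vec ?R"
    using carrier_vecD[OF rotation_mult_vec_carrier[OF PW], of "- \<theta>"] noncons_carrier(2)[of N U]
    by simp
  fix i assume "i < dim_vec ?R"
  then have i: "i < 2 * N + 3"
    using carrier_vecD[OF rotation_mult_vec_carrier[OF PW], of "- \<theta>"] by simp
  have L: "?L $ i = cos \<theta> * (P_noncons N U *\<^sub>v W) $ i + sin \<theta> * (Q_noncons N U *\<^sub>v W) $ i"
    using i noncons_carrier[of N U] by simp
  \<comment> \<open>Facts 1-3 rotate the result back, 4-6 rotate \<open>W\<close>, and 7-8 are the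
    back rotation of the momentum pair j = 0.\<close>
  note rot = rotation_mult_vec[OF PW, where \<theta> = "- \<theta>"]
    rotation_mult_vec[OF W, where \<theta> = \<theta>]
    rotation_mult_vec(2,3)[OF PW, where j = 0 and \<theta> = "- \<theta>"]
  note blocks = blocks_mult_vec[OF block_carrier(1) W, of _ U, folded P_noncons_def]
    blocks_mult_vec[OF block_carrier(2) W, of _ U, folded Q_noncons_def]
    blocks_mult_vec[OF block_carrier(1) W', of _ ?U, folded P_noncons_def]
  have entries: "p_block V $$ (0, 0) = - u_mean V" "p_block V $$ (1, 0) = - v_mean V"
    "p_block V $$ (0, 1) = 0" "p_block V $$ (1, 1) = 0"
    "q_block V $$ (0, 1) = - u_mean V" "q_block V $$ (1, 1) = - v_mean V"
    "q_block V $$ (0, 0) = 0" "q_block V $$ (1, 0) = 0" for V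
    by (simp_all add: p_block_def q_block_def mat_of_rows_list_def)
  show "?L $ i = ?R $ i"
    using i
  proof (cases i rule: index_cases)
    case 1
    \<comment> \<open>The nonconservative part vanishes in components 0, 1 and 2, and the rotation
      mixes components 1 and 2 only with each other, so the first three cases reduce to 0 =
      0.\<close>
    then show ?thesis
      unfolding L by (simp add: rot blocks)
  next
    case 2
    then show ?thesis
      unfolding L using rot(7) by (simp add: blocks numeral_2_eq_2)
  next
    case 3
    then show ?thesis
      unfolding L using rot(8) by (simp add: blocks numeral_2_eq_2)
  next
    case (4 j)
    then have "j \<le> N"
      by simp
    then show ?thesis
      unfolding L
      unfolding 4(2) rot(2,5,6)[OF \<open>j \<le> N\<close>] blocks(2,3,5,6,8,9)[OF 4(1)] entries rotated_state[OF U]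
        cos_minus sin_minus
      by (simp add: algebra_simps sin_mult_sin)
  next
    case (5 j)
    then have "j \<le> N"
      by simp
    then show ?thesis
      unfolding L
      unfolding 5(2) rot(3,5,6)[OF \<open>j \<le> N\<close>] blocks(2,3,5,6,8,9)[OF 5(1)] entries rotated_state[OF U]
        cos_minus sin_minus
      by (simp add: algebra_simps sin_mult_sin)
  qed
qed

section \<open>From the action on vectors to the matrix identity\<close>

lemma smult_mult_mat_vec:
  fixes A :: "real mat"
  assumes "A \<in> carrier_mat n m" "W \<in> carrier_vec m"
  shows "(c \<cdot>\<^sub>m A) *\<^sub>v W = c \<cdot>\<^sub>v (A *\<^sub>v W)"
  using assms by (intro eq_vecI) auto

lemma smult_add_vec_interchange:
  fixes a b p q :: "real vec"
  assumes "a \<in> carrier_vec n" "b \<in> carrier_vec n" "p \<in> carrier_vec n" "q \<in> carrier_vec n"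
  shows "c \<cdot>\<^sub>v (a + p) + s \<cdot>\<^sub>v (b + q) = (c \<cdot>\<^sub>v a + s \<cdot>\<^sub>v b) + (c \<cdot>\<^sub>v p + s \<cdot>\<^sub>v q)"
  using assms by (intro eq_vecI) (auto simp: algebra_simps)

text \<open>Unit vectors pick out the columns. This reduces the matrix identity to vectors, the form
  in which the Jacobian and nonconservative identities are available.\<close>

lemma eq_mat_mult_vecI:
  fixes A B :: "real mat"
  assumes A: "A \<in> carrier_mat n m" and B: "B \<in> carrier_mat n m"
    and eq: "\<And>W. W \<in> carrier_vec m \<Longrightarrow> A *\<^sub>v W = B *\<^sub>v W"
  shows "A = B"
proof (rule eq_matI)
  fix i j assume "i < dim_row B" "j < dim_col B"
  then have ij: "i < n" "j < m"
    using B by auto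
  have "(A *\<^sub>v unit_vec m j) $ i = (B *\<^sub>v unit_vec m j) $ i"
    by (simp add: eq)
  then show "A $$ (i, j) = B $$ (i, j)"
    using A B ij by simp
qed (use A B in auto)

theorem theorem3p1:
  fixes N :: nat and G \<theta> :: real and U :: "real vec"
  assumes "G > 0" and "\<theta> \<in> {0..<2 * pi}" and "U \<in> state_space N"
  shows "cos \<theta> \<cdot>\<^sub>m A_coeff N G U + sin \<theta> \<cdot>\<^sub>m B_coeff N G U =
    the (mat_inverse (rotation N \<theta>)) * A_coeff N G (rotation N \<theta> *\<^sub>v U) * rotation N \<theta>"
proof -
  let ?n = "2 * N + 3" and ?T = "rotation N \<theta>" and ?M = "rotation N (- \<theta>)"
  let ?JF = "jacobian (flux_x N G)" and ?JG = "jacobian (flux_y N G)"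
  have U: "U \<in> carrier_vec ?n"
    using assms(3) by (simp add: state_space_def)
  have TU: "?T *\<^sub>v U \<in> carrier_vec ?n"
    by (rule rotation_mult_vec_carrier[OF U])
  have J: "?JF V \<in> carrier_mat ?n ?n" "?JG V \<in> carrier_mat ?n ?n" if "V \<in> carrier_vec ?n" for V
    using jacobian_carrier[of "flux_x N G" V] jacobian_carrier[of "flux_y N G" V] that
    by (simp_all add: flux_x_index(1) flux_y_index(1))
  note P = noncons_carrier(1) and Q = noncons_carrier(2)
  have A: "A_coeff N G V \<in> carrier_mat ?n ?n" and B: "B_coeff N G V \<in> carrier_mat ?n ?n"
    if "V \<in> carrier_vec ?n" for V
    unfolding A_coeff_def B_coeff_def using P Q by simp_all
  \<comment> \<open>By \<open>mat_inverse_rotation\<close> the inverse of T(\<theta>) is the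
    rotation by - \<theta>, so the claim is proved with \<open>?M\<close> in its place.\<close>
  have "cos \<theta> \<cdot>\<^sub>m A_coeff N G U + sin \<theta> \<cdot>\<^sub>m B_coeff N G U = ?M * A_coeff N G (?T *\<^sub>v U) * ?T"
  proof (rule eq_mat_mult_vecI[of _ ?n ?n])
    show "cos \<theta> \<cdot>\<^sub>m A_coeff N G U + sin \<theta> \<cdot>\<^sub>m B_coeff N G U \<in> carrier_mat ?n ?n"
      using B[OF U] by simp
    show "?M * A_coeff N G (?T *\<^sub>v U) * ?T \<in> carrier_mat ?n ?n"
      by (rule mult_carrier_mat[OF mult_carrier_mat[OF rotation_carrier A[OF TU]] rotation_carrier])
    fix W :: "real vec" assume W: "W \<in> carrier_vec ?n"
    note TW = rotation_mult_vec_carrier[OF W, of \<theta>]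
    have vecs: "?JF U *\<^sub>v W \<in> carrier_vec ?n" "?JG U *\<^sub>v W \<in> carrier_vec ?n"
      "P_noncons N U *\<^sub>v W \<in> carrier_vec ?n" "Q_noncons N U *\<^sub>v W \<in> carrier_vec ?n"
      "?JF (?T *\<^sub>v U) *\<^sub>v (?T *\<^sub>v W) \<in> carrier_vec ?n"
      "P_noncons N (?T *\<^sub>v U) *\<^sub>v (?T *\<^sub>v W) \<in> carrier_vec ?n"
      using J[OF U] J[OF TU] P Q W TW mult_mat_vec_carrier by blast+
    have "(cos \<theta> \<cdot>\<^sub>m A_coeff N G U + sin \<theta> \<cdot>\<^sub>m B_coeff N G U) *\<^sub>v W =
        cos \<theta> \<cdot>\<^sub>v (A_coeff N G U *\<^sub>v W) + sin \<theta> \<cdot>\<^sub>v (B_coeff N G U *\<^sub>v W)"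
      using A[OF U] B[OF U] W
      by (simp add: add_mult_distrib_mat_vec[of _ ?n ?n] smult_mult_mat_vec[of _ ?n ?n])
    also have "\<dots> = cos \<theta> \<cdot>\<^sub>v (?JF U *\<^sub>v W + P_noncons N U *\<^sub>v W) +
        sin \<theta> \<cdot>\<^sub>v (?JG U *\<^sub>v W + Q_noncons N U *\<^sub>v W)"
      unfolding A_coeff_def B_coeff_def
        add_mult_distrib_mat_vec[OF J(1)[OF U] P W] add_mult_distrib_mat_vec[OF J(2)[OF U] Q W] ..
    \<comment> \<open>Regroup from x- and y-parts into a Jacobian part and a nonconservative part,
      each with its own rotation identity.\<close>
    also have "\<dots> = (cos \<theta> \<cdot>\<^sub>v (?JF U *\<^sub>v W) + sin \<theta> \<cdot>\<^sub>v (?JG U *\<^sub>v W)) +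
        (cos \<theta> \<cdot>\<^sub>v (P_noncons N U *\<^sub>v W) + sin \<theta> \<cdot>\<^sub>v (Q_noncons N U *\<^sub>v W))"
      by (rule smult_add_vec_interchange[OF vecs(1-4)])
    also have "\<dots> = ?M *\<^sub>v (?JF (?T *\<^sub>v U) *\<^sub>v (?T *\<^sub>v W)) +
        ?M *\<^sub>v (P_noncons N (?T *\<^sub>v U) *\<^sub>v (?T *\<^sub>v W))"
      unfolding jacobian_rotation[OF assms(3) W] noncons_rotation[OF U W] ..
    also have "\<dots> = ?M *\<^sub>v (?JF (?T *\<^sub>v U) *\<^sub>v (?T *\<^sub>v W) + P_noncons N (?T *\<^sub>v U) *\<^sub>v (?T *\<^sub>v W))"
      by (rule mult_add_distrib_mat_vec[OF rotation_carrier vecs(5,6), symmetric])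
    also have "\<dots> = ?M *\<^sub>v (A_coeff N G (?T *\<^sub>v U) *\<^sub>v (?T *\<^sub>v W))"
      unfolding A_coeff_def add_mult_distrib_mat_vec[OF J(1)[OF TU] P TW] ..
    also have "\<dots> = (?M * A_coeff N G (?T *\<^sub>v U) * ?T) *\<^sub>v W"
      unfolding assoc_mult_mat_vec[OF mult_carrier_mat[OF rotation_carrier A[OF TU]] rotation_carrier W]
        assoc_mult_mat_vec[OF rotation_carrier A[OF TU] TW] ..
    finally show "(cos \<theta> \<cdot>\<^sub>m A_coeff N G U + sin \<theta> \<cdot>\<^sub>m B_coeff N G U) *\<^sub>v W =
        (?M * A_coeff N G (?T *\<^sub>v U) * ?T) *\<^sub>v W" .
  qed
  then show ?thesis
    by (simp add: mat_inverse_rotation)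
qed

end
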